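(* Let $n$ be a Deaconescu number such that $n \in D_3$, i.e. $3\,S_2(n) = \phi(n) - 1$. Then every prime divisor of $n$ is congruent to $2$ modulo $3$, and $\omega(n) \geq 48$.
   Context: $\phi$ denotes Euler's totient function and $\omega(n)$ denotes the number of distinct prime divisors of $n$. $S_2$ denotes Schemmel's totient function: the multiplicative function on positive integers defined on prime powers ($k \geq 1$) by $S_2(2^k) = 0$ and $S_2(p^k) = p^{k-1}(p-2)$ for primes $p > 2$. A Deaconescu number is a positive composite integer $n \geq 4$ such that $S_2(n) \mid \phi(n) - 1$. For an integer $M \geq 1$, $D_M$ denotes the set of integers $n \geq 2$ satisfying $M\,S_2(n) = \phi(n) - 1$. *)

theory Defs
  imports "HOL-Number_Theory.Number_Theory"
begin

text \<open>
  Schemmel's totient function \<open>S\<^sub>2\<close>. The factor at the prime 2 is 0, because \<open>p - 2 = 0\<close> there.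
  The lemmas below show that this is the multiplicative function with the prescribed values
  on prime powers. The value at \<open>n = 0\<close> is irrelevant.
\<close>
definition schemmel2 :: "nat \<Rightarrow> nat" where
  "schemmel2 n = (\<Prod>p\<in>prime_factors n. p ^ (multiplicity p n - 1) * (p - 2))"

lemma schemmel2_1: "schemmel2 1 = 1"
  by (simp add: schemmel2_def)

lemma schemmel2_prime_power:
  assumes "prime p" "k \<ge> 1"
  shows "schemmel2 (p ^ k) = p ^ (k - 1) * (p - 2)"
proof -
  have "prime_factors (p ^ k) = {p}"
    using assms by (simp add: prime_factorization_prime_power)
  moreover have "multiplicity p (p ^ k) = k"
    using assms by (simp add: prime_nat_iff multiplicity_same_power)
  ultimately show ?thesis
    by (simp add: schemmel2_def)
qed

lemma schemmel2_2_power: "k \<ge> 1 \<Longrightarrow> schemmel2 (2 ^ k) = 0"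
  by (simp add: schemmel2_prime_power)

lemma schemmel2_mult_coprime:
  assumes "coprime m n" "m > 0" "n > 0"
  shows "schemmel2 (m * n) = schemmel2 m * schemmel2 n"
proof -
  let ?f = "\<lambda>n p. p ^ (multiplicity p n - 1) * (p - 2)"
  have pf: "prime_factors (m * n) = prime_factors m \<union> prime_factors n"
    using assms by (simp add: prime_factors_product)
  have disj: "prime_factors m \<inter> prime_factors n = {}"
    using assms(1) by (metis coprime_common_divisor disjoint_iff in_prime_factors_iff not_prime_unit)
  have A: "?f (m * n) p = ?f m p" if "p \<in> prime_factors m" for p
  proof -
    have "p \<notin> prime_factors n" using that disj by auto
    hence "\<not> p dvd n" using that assms(3) by (auto simp: prime_factors_dvd)
    thus ?thesis using that assms
      by (simp add: prime_elem_multiplicity_mult_distrib not_dvd_imp_multiplicity_0 in_prime_factors_iff)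
  qed
  have B: "?f (m * n) p = ?f n p" if "p \<in> prime_factors n" for p
  proof -
    have "p \<notin> prime_factors m" using that disj by auto
    hence "\<not> p dvd m" using that assms(2) by (auto simp: prime_factors_dvd)
    thus ?thesis using that assms
      by (simp add: prime_elem_multiplicity_mult_distrib not_dvd_imp_multiplicity_0 in_prime_factors_iff)
  qed
  show ?thesis
    unfolding schemmel2_def pf prod.union_disjoint[OF finite_set_mset finite_set_mset disj]
    by (intro arg_cong2[where f = times] prod.cong refl A B)
qed

definition omega :: "nat \<Rightarrow> nat" where
  "omega n = card (prime_factors n)"

text \<open>
  Natural-number subtraction below is genuine subtraction, since \<open>totient n \<ge> 1\<close> for \<open>n \<ge> 1\<close>.
\<close>
definition deaconescu :: "nat \<Rightarrow> bool" where
  "deaconescu n \<longleftrightarrow> n \<ge> 4 \<and> \<not> prime n \<and> schemmel2 n dvd totient n - 1"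

definition D_set :: "nat \<Rightarrow> nat set" where
  "D_set M = {n. n \<ge> 2 \<and> M * schemmel2 n = totient n - 1}"

end

theory Submission
  imports Defs
begin

text \<open>
  Write the equation as \<open>\<phi>(n) = 3 S\<^sub>2(n) + 1\<close>. It has two kinds of consequences.

  Arithmetically, it makes \<open>\<phi>(n)\<close> and \<open>S\<^sub>2(n)\<close> coprime. A repeated prime factor of \<open>n\<close> would divide
  both, so \<open>n\<close> is squarefree and \<open>\<phi>(n)\<close> is the product of the numbers \<open>p - 1\<close> over the primes \<open>p\<close>
  dividing \<open>n\<close>. This product is congruent to 1 modulo 3. No prime factor is therefore congruent
  to 1 modulo 3, and the prime factors congruent to 2 contribute only factors congruent to 1. If 3
  divided \<open>n\<close>, its factor \<open>3 - 1 = 2\<close> would make the product congruent to 2. Hence all prime factors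
  are congruent to 2 modulo 3. They are also odd, since \<open>S\<^sub>2\<close> vanishes at even numbers.

  By size, the equation says that the product of \<open>(p - 1) / (p - 2)\<close> over the primes dividing \<open>n\<close>
  exceeds 3. These primes are distinct and congruent to 5 modulo 6, and \<open>(p - 1) / (p - 2)\<close>
  decreases with \<open>p\<close>. So the product over \<open>k\<close> such primes is at most the product over the first
  \<open>k\<close> terms of 5, 11, 17, 23, \<open>\<dots>\<close>, whether or not these are prime. The sixth power of the
  latter product is at most \<open>12 k + 1\<close>, which is below \<open>3\<^sup>6 = 729\<close> for \<open>k \<le> 47\<close>.
\<close>

text \<open>
  The \<open>i\<close>-th smallest element of \<open>T\<close> is at least \<open>i\<close>, so compressing \<open>T\<close> to an initial segment can only
  increase each factor. The induction removes the maximum.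
\<close>
lemma prod_antimono_le_prod_initial_segment:
  fixes f :: "nat \<Rightarrow> 'a :: linordered_semidom"
  assumes "finite T" "antimono f" "\<And>i. f i \<ge> 0"
  shows "(\<Prod>i\<in>T. f i) \<le> (\<Prod>i<card T. f i)"
  using assms(1)
proof (induction T rule: finite_linorder_max_induct)
  case empty
  show ?case by simp
next
  case (insert b A)
  have "A \<subseteq> {..<b}" using insert.hyps by auto
  hence "card A \<le> b" using card_mono[of "{..<b}" A] by simp
  hence "f b \<le> f (card A)" using assms(2) by (rule_tac antimonoD)
  moreover have "b \<notin> A" using insert.hyps by auto
  ultimately show ?case
    using insert assms(3) by (simp add: mult_mono prod_nonneg mult.commute)
qed

text \<open>A repeated prime factor would divide both \<open>\<phi>(n)\<close> and \<open>S\<^sub>2(n)\<close>, which are coprime here.\<close>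
lemma multiplicity_eq_1_if_totient_eq:
  assumes "n > 0" "totient n = M * schemmel2 n + 1" "p \<in> prime_factors n"
  shows "multiplicity p n = 1"
proof (rule ccontr)
  assume "multiplicity p n \<noteq> 1"
  moreover have "multiplicity p n > 0"
    using assms(3) by (simp add: prime_factors_multiplicity)
  ultimately have p: "p dvd p ^ (multiplicity p n - 1)"
    by (intro dvd_power) auto
  have "p ^ (multiplicity p n - 1) * (p - 1) dvd totient n"
    unfolding totient_formula1[OF assms(1)] using assms(3)
    by (rule dvd_prodI[OF finite_set_mset])
  hence tot: "p dvd totient n"
    by (rule dvd_trans[OF dvd_mult2[OF p]])
  have "p ^ (multiplicity p n - 1) * (p - 2) dvd schemmel2 n"
    unfolding schemmel2_def using assms(3) by (rule dvd_prodI[OF finite_set_mset])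
  hence "p dvd schemmel2 n"
    by (rule dvd_trans[OF dvd_mult2[OF p]])
  hence "p dvd M * schemmel2 n"
    by (rule dvd_mult)
  hence "p dvd 1"
    using tot unfolding assms(2) by (simp only: dvd_add_right_iff)
  thus False using assms(3) by (simp add: in_prime_factors_iff)
qed

lemma odd_if_totient_eq:
  assumes "n > 2" "totient n = M * schemmel2 n + 1"
  shows "odd n"
proof
  assume "even n"
  hence "2 \<in> prime_factors n" using assms(1) by (simp add: in_prime_factors_iff)
  hence "schemmel2 n = 0" unfolding schemmel2_def by (auto intro!: bexI[of _ 2])
  thus False using totient_gt_1[OF assms(1)] assms(2) by simp
qed

text \<open>
  Squarefreeness is what makes the residue of \<open>\<phi>(n)\<close> computable here: otherwise powers of primes
  congruent to 2 would enter the product and could turn the contribution 2 of the prime 3 into 1.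
\<close>
lemma prime_factors_cong_2_mod_3:
  assumes "n > 0" "totient n = 3 * schemmel2 n + 1" "p \<in> prime_factors n"
  shows "p mod 3 = 2"
proof -
  have tot: "totient n = (\<Prod>q\<in>prime_factors n. q - 1)"
    unfolding totient_formula1[OF assms(1)]
    by (intro prod.cong refl) (simp add: multiplicity_eq_1_if_totient_eq[OF assms(1,2)])
  have tot_mod: "totient n mod 3 = 1" using assms(2) by presburger
  have not1: "q mod 3 \<noteq> 1" if "q \<in> prime_factors n" for q
  proof
    assume "q mod 3 = 1"
    hence "3 dvd q - 1" by presburger
    also have "q - 1 dvd totient n" unfolding tot using that by (intro dvd_prodI) auto
    finally show False using tot_mod by presburger
  qed
  have mod2: "q mod 3 = 2" if "q \<in> prime_factors n" "q \<noteq> 3" for q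
  proof -
    have "\<not> 3 dvd q"
      using that by (auto simp: in_prime_factors_iff prime_nat_iff)
    hence "q mod 3 \<noteq> 0" by (simp add: dvd_eq_mod_eq_0)
    thus ?thesis using not1[OF that(1)] by linarith
  qed
  have not3: "3 \<notin> prime_factors n"
  proof
    assume 3: "3 \<in> prime_factors n"
    have "[(\<Prod>q\<in>prime_factors n - {3}. q - 1) = (\<Prod>q\<in>prime_factors n - {3}. 1)] (mod 3)"
    proof (rule cong_prod)
      fix q assume "q \<in> prime_factors n - {3}"
      hence "q mod 3 = 2" by (intro mod2) auto
      then obtain k where "q = 3 * k + 2" by (metis mult_div_mod_eq)
      hence "(q - 1) mod 3 = 1" by simp
      thus "[q - 1 = 1] (mod 3)" by (simp add: cong_def)
    qed
    hence "[2 * (\<Prod>q\<in>prime_factors n - {3}. q - 1) = 2 * 1] (mod 3)"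
      by (intro cong_scalar_left) simp
    moreover have "totient n = 2 * (\<Prod>q\<in>prime_factors n - {3}. q - 1)"
      unfolding tot by (subst prod.remove[OF _ 3]) auto
    ultimately show False using tot_mod by (simp add: cong_def)
  qed
  show ?thesis using mod2[OF assms(3)] not3 assms(3) by blast
qed

text \<open>
  The multiplicities cancel in the quotient \<open>\<phi>(n) / S\<^sub>2(n)\<close>. Writing \<open>p = 6 i + 5\<close>, the factor
  \<open>(p - 1) / (p - 2)\<close> becomes \<open>(6 i + 4) / (6 i + 3)\<close>, and distinct primes have distinct indices \<open>i\<close>.
\<close>
lemma totient_le_prod_mult_schemmel2:
  assumes "n > 0" "\<And>p. p \<in> prime_factors n \<Longrightarrow> p mod 6 = 5"
  shows "real (totient n) \<le> (\<Prod>i<omega n. (6 * real i + 4) / (6 * real i + 3)) * real (schemmel2 n)"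
proof -
  let ?P = "prime_factors n"
  let ?f = "\<lambda>i. (6 * real i + 4) / (6 * real i + 3)"
  have inj: "inj_on (\<lambda>p. p div 6) ?P"
    using assms(2) by (intro inj_onI) (metis div_mult_mod_eq)
  have factor: "real (p - 1) = ?f (p div 6) * real (p - 2)" if "p \<in> ?P" for p
  proof -
    have "p = 6 * (p div 6) + 5" using assms(2)[OF that] by presburger
    then obtain i where p: "p = 6 * i + 5" by blast
    have "6 * real i + 3 \<noteq> 0" by linarith
    thus ?thesis by (simp add: p add.commute)
  qed
  have "real (totient n) = (\<Prod>p\<in>?P. ?f (p div 6)) * real (schemmel2 n)"
    unfolding totient_formula1[OF assms(1)] schemmel2_def of_nat_prod prod.distrib[symmetric]
    by (intro prod.cong refl) (simp only: of_nat_mult factor mult_ac)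
  also have "(\<Prod>p\<in>?P. ?f (p div 6)) = (\<Prod>i\<in>(\<lambda>p. p div 6) ` ?P. ?f i)"
    by (simp add: prod.reindex[OF inj])
  also have "\<dots> \<le> (\<Prod>i<card ((\<lambda>p. p div 6) ` ?P). ?f i)"
  proof (rule prod_antimono_le_prod_initial_segment)
    show "antimono ?f"
    proof (rule antimonoI)
      fix i j :: nat assume "i \<le> j"
      thus "?f j \<le> ?f i" by (simp add: field_simps)
    qed
  qed auto
  also have "card ((\<lambda>p. p div 6) ` ?P) = omega n"
    by (simp add: card_image[OF inj] omega_def)
  finally show ?thesis by (simp add: mult_right_mono)
qed

text \<open>
  With \<open>x = 6 i + 3\<close>, the ratio \<open>(2 x + 7) / (2 x - 5)\<close> of consecutive values of \<open>12 i + 1\<close> agrees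
  with \<open>(1 + 1 / x)\<^sup>6\<close> up to second order in \<open>1 / x\<close> and dominates it, so the sixth power of the product
  telescopes.
\<close>
lemma prod_power_6_le:
  "(\<Prod>i<k. (6 * real i + 4) / (6 * real i + 3)) ^ 6 \<le> 12 * real k + 1"
proof (induction k)
  case 0
  show ?case by simp
next
  case (Suc k)
  define x where "x = 6 * real k + 3"
  have x: "x > 0" by (simp add: x_def)
  have "(2 * x + 7) * x ^ 6 - (2 * x - 5) * (x + 1) ^ 6
          = 35 * x ^ 4 + 70 * x ^ 3 + 63 * x ^ 2 + 28 * x + 5"
    by (simp add: algebra_simps power_numeral_reduce)
  also have "\<dots> \<ge> 0" using x by simp
  finally have ineq: "(2 * x - 5) * (x + 1) ^ 6 \<le> (2 * x + 7) * x ^ 6" by simp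
  have "(\<Prod>i<Suc k. (6 * real i + 4) / (6 * real i + 3)) ^ 6
          = (\<Prod>i<k. (6 * real i + 4) / (6 * real i + 3)) ^ 6 * ((x + 1) / x) ^ 6"
    by (simp only: prod.lessThan_Suc power_mult_distrib) (simp add: x_def add.commute)
  also have "\<dots> \<le> (12 * real k + 1) * ((x + 1) / x) ^ 6"
    using Suc.IH by (rule mult_right_mono) (use x in simp)
  also have "\<dots> = (2 * x - 5) * (x + 1) ^ 6 / x ^ 6"
    by (simp add: x_def power_divide)
  also have "\<dots> \<le> 2 * x + 7"
    using ineq x by (simp add: pos_divide_le_eq)
  also have "\<dots> = 12 * real (Suc k) + 1" by (simp add: x_def)
  finally show ?case .
qed

theorem theorem1p1:
  fixes n :: nat
  assumes "deaconescu n" and "n \<in> D_set 3"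
  shows "(\<forall>p. prime p \<and> p dvd n \<longrightarrow> [p = 2] (mod 3)) \<and> omega n \<ge> 48"
proof -
  have n: "n \<ge> 4" using assms(1) by (simp add: deaconescu_def)
  have eq: "totient n = 3 * schemmel2 n + 1"
    using assms(2) totient_gt_1[of n] n by (simp add: D_set_def)
  have mod3: "p mod 3 = 2" if "p \<in> prime_factors n" for p
    using that eq n by (intro prime_factors_cong_2_mod_3[of n]) auto
  have "odd n" using odd_if_totient_eq[OF _ eq] n by simp
  hence odd_p: "odd p" if "p \<in> prime_factors n" for p
    using that by (meson dvd_trans in_prime_factors_iff)
  hence mod6: "p mod 6 = 5" if "p \<in> prime_factors n" for p
    using mod3[OF that] odd_p[OF that] by presburger
  have "omega n \<ge> 48"
  proof (rule ccontr)
    assume "\<not> omega n \<ge> 48"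
    hence "(\<Prod>i<omega n. (6 * real i + 4) / (6 * real i + 3)) ^ 6 \<le> 3 ^ 6"
      by (intro order_trans[OF prod_power_6_le]) simp
    hence "(\<Prod>i<omega n. (6 * real i + 4) / (6 * real i + 3)) \<le> 3"
      by (subst (asm) power_mono_iff) (auto intro: prod_nonneg)
    hence "(\<Prod>i<omega n. (6 * real i + 4) / (6 * real i + 3)) * real (schemmel2 n)
             \<le> 3 * real (schemmel2 n)"
      by (rule mult_right_mono) simp
    hence "real (totient n) \<le> 3 * real (schemmel2 n)"
      using totient_le_prod_mult_schemmel2[of n, OF _ mod6] n by linarith
    thus False using eq by simp
  qed
  moreover have "[p = 2] (mod 3)" if "prime p" "p dvd n" for p
    using mod3[of p] that n by (simp add: in_prime_factors_iff cong_def)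
  ultimately show ?thesis by blast
qed

end
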